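(* Let $\vec{x}=(x_0,\dots,x_{n-1})$, $\vec{y}=(y_0,\dots,y_{n-1})$ and $\vec{z}=(z_0,\dots,z_{l-1})$ be tuples of variables. Then $$=\!(\vec{x}\vec{z},\vec{y})\ \vdash\ \bigwedge_{i<n} y_i\perp_{\vec{x}\vec{z}}\{y_j \mid j\neq i\},$$ where $\vdash$ is derivability by the rules listed in the context.
   Context: Syntax. Variables have sorts in $\mathbb{N}$. A vocabulary $\tau$ consists of a set $S_\tau\subseteq\mathbb{N}$ of sorts and sorted relation symbols. Formulas of independence logic are built from literals ($u=v$, $R(\vec{x})$ and their negations) and independence atoms $\vec{y}\perp_{\vec{x}}\vec{z}$ (finite, possibly empty, tuples of variables) by $\wedge,\vee,\exists,\forall$ and the new-sort quantifiers $\tilde\exists v,\tilde\forall v$, where $\tilde\exists v\varphi$, $\tilde\forall v\varphi$ are $\tau$-formulas when $\mathrm{sort}(v)\notin S_\tau$ and $\varphi$ is a formula of $\tau$ enlarged by the sort $\mathrm{sort}(v)$ in which no variable of that sort other than $v$ is free. $=\!(\vec{x},\vec{y})$ abbreviates $\vec{y}\perp_{\vec{x}}\vec{y}$. Dependence logic is the fragment in which only independence atoms of the form $\vec{y}\perp_{\vec{x}}\vec{y}$ occur. Juxtaposition of tuples is concatenation, and a finite set of indexed variables inside an atom is read as a tuple listing it. Rules. $\Sigma\vdash\psi$ is the least relation (between sets of formulas and formulas of a common vocabulary), closed under the usual structural rules (assumption, weakening, cut), given by: (I) Independence atom: Constancy: $\vec{y}\perp_{\vec{x}}\vec{y}$ entails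 $\vec{y}\perp_{\vec{x}}\vec{z}$. Reflexivity: $\vec{x}\perp_{\vec{x}}\vec{y}$. Symmetry: $\vec{z}\perp_{\vec{x}}\vec{y}$ entails $\vec{y}\perp_{\vec{x}}\vec{z}$. Weakening: $\vec{y}y'\perp_{\vec{x}}\vec{z}z'$ entails $\vec{y}\perp_{\vec{x}}\vec{z}$. Permutation: each of the three tuples may be permuted. Fixed Parameter: $\vec{z}\perp_{\vec{x}}\vec{y}$ entails $\vec{y}\vec{x}\perp_{\vec{x}}\vec{z}\vec{x}$. First Transitivity: $\vec{x}\perp_{\vec{z}}\vec{y}\wedge\vec{u}\perp_{\vec{z}\vec{x}}\vec{y}$ entails $\vec{u}\perp_{\vec{z}}\vec{y}$. Second Transitivity: $\vec{y}\perp_{\vec{z}}\vec{y}\wedge\vec{z}\vec{x}\perp_{\vec{y}}\vec{u}$ entails $\vec{x}\perp_{\vec{z}}\vec{u}$. Exchange: $\vec{x}\perp_{\vec{z}}\vec{y}\wedge\vec{x}\vec{y}\perp_{\vec{z}}\vec{u}$ entails $\vec{x}\perp_{\vec{z}}\vec{y}\vec{u}$. (II) Dependence atom: $=\!(\vec{x}\vec{y},\vec{x})$; $=\!(\vec{x},\vec{y})\wedge=\!(\vec{y},\vec{z})$ entails $=\!(\vec{x},\vec{z})$; $=\!(\vec{x},\vec{y})$ entails $=\!(\vec{x},\vec{x}\vec{y})$; both tuples may be permuted. (III) Semigraphoid axioms: $\vec{x}\perp_{\vec{z}}\emptyset$; Symmetry; $\vec{x}\perp_{\vec{z}}\vec{y}\vec{w}$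 entails $\vec{x}\perp_{\vec{z}}\vec{y}$ (Decomposition) and entails $\vec{x}\perp_{\vec{z}\vec{w}}\vec{y}$ (Weak Union); $\vec{x}\perp_{\vec{z}}\vec{y}\wedge\vec{x}\perp_{\vec{z}\vec{y}}\vec{w}$ entails $\vec{x}\perp_{\vec{z}}\vec{y}\vec{w}$ (Contraction); Permutation; $\vec{x}\perp_{\vec{z}}\vec{y}$ entails $\vec{x}\vec{x}\perp_{\vec{z}\vec{z}}\vec{y}\vec{y}$ (Repetition). (IV) Logical rules: ($\exists$-elimination) if $\Sigma\cup\{\varphi\}\vdash\psi$ and $x$ is not free in $\psi$ or in any member of $\Sigma$, then $\Sigma\cup\{\exists x\varphi\}\vdash\psi$. ($\exists$-introduction) if $y$ has the same sort as $x$ and no free occurrence of $x$ in $\varphi$ lies in the scope of a quantifier $Qy$, then $\varphi(y/x)$ entails $\exists x\varphi$. ($\wedge$) $\varphi\wedge\psi$ entails $\varphi$ and $\psi$; $\{\varphi,\psi\}$ entails $\varphi\wedge\psi$. (Dependence introduction) $\exists x\varphi$ entails $\exists x(=\!(\vec{z},x)\wedge\varphi)$ whenever $\varphi$ is a formula of dependence logic and $\vec{z}$ lists the free variables of $\exists x\varphi$. (First $\tilde\exists$-introduction) if no variable of sort $\mathrm{sort}(x)$ occurs in any formula of $\Sigma$ and $\Sigma\vdash\exists x\varphi$, then $\Sigma\vdash\tilde\exists x\varphi$. (Second $\tilde\exists$-introduction) if no variable of sort $\mathrm{sort}(x)$ occurs in any formula of $\Sigma$ and $\Sigma\cup\{\exists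 x\varphi\}\vdash\exists y\psi$, where $\mathrm{sort}(y)=\mathrm{sort}(x)$, then $\Sigma\cup\{\tilde\exists x\varphi\}\vdash\tilde\exists y\psi$. *)

theory Defs
  imports "HOL-Library.Multiset"
begin

section \<open>Syntax\<close>

datatype var = Var (sort_of: nat) (vname: nat)

record 'r vocab =
  sorts :: "nat set"
  rel_sorts :: "'r \<Rightarrow> nat list option"

definition vocabulary :: "'r vocab \<Rightarrow> bool" where
  "vocabulary \<tau> \<longleftrightarrow> (\<forall>R ss. rel_sorts \<tau> R = Some ss \<longrightarrow> set ss \<subseteq> sorts \<tau>)"

definition add_sort :: "nat \<Rightarrow> 'r vocab \<Rightarrow> 'r vocab" where
  "add_sort s \<tau> = \<tau>\<lparr>sorts := insert s (sorts \<tau>)\<rparr>"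

text \<open>
  The three arguments of an independence atom are written in the order in which they are read:
  the atom says that the first tuple is independent of the third one, given the second one.
  \<open>NewEx\<close> and \<open>NewAll\<close> are the quantifiers that introduce a new sort.
\<close>

datatype 'r fm =
    Eq var var
  | Neq var var
  | Rel 'r "var list"
  | NegRel 'r "var list"
  | Indep "var list" "var list" "var list"  ("(_ \<bottom>\<^bsub>_\<^esub> _)" [66, 0, 66] 65)
  | And "'r fm" "'r fm"
  | Or "'r fm" "'r fm"
  | Ex var "'r fm"
  | All var "'r fm"
  | NewEx var "'r fm"
  | NewAll var "'r fm"

abbreviation dep :: "var list \<Rightarrow> var list \<Rightarrow> 'r fm" where
  "dep xs ys \<equiv> ys \<bottom>\<^bsub>xs\<^esub> ys"

text \<open>
  There is no constant for truth in the syntax; the empty conjunction is the valid atom whose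
  three tuples are empty.
\<close>

fun bigconj :: "'r fm list \<Rightarrow> 'r fm" where
  "bigconj [] = [] \<bottom>\<^bsub>[]\<^esub> []"
| "bigconj [\<phi>] = \<phi>"
| "bigconj (\<phi> # \<psi> # \<chi>s) = And \<phi> (bigconj (\<psi> # \<chi>s))"

primrec free_vars :: "'r fm \<Rightarrow> var set" where
  "free_vars (Eq u v) = {u, v}"
| "free_vars (Neq u v) = {u, v}"
| "free_vars (Rel R vs) = set vs"
| "free_vars (NegRel R vs) = set vs"
| "free_vars (ys \<bottom>\<^bsub>xs\<^esub> zs) = set ys \<union> set xs \<union> set zs"
| "free_vars (And \<phi> \<psi>) = free_vars \<phi> \<union> free_vars \<psi>"
| "free_vars (Or \<phi> \<psi>) = free_vars \<phi> \<union> free_vars \<psi>"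
| "free_vars (Ex v \<phi>) = free_vars \<phi> - {v}"
| "free_vars (All v \<phi>) = free_vars \<phi> - {v}"
| "free_vars (NewEx v \<phi>) = free_vars \<phi> - {v}"
| "free_vars (NewAll v \<phi>) = free_vars \<phi> - {v}"

text \<open>All variables that occur, including the bound ones and those following a quantifier.\<close>

primrec occ_vars :: "'r fm \<Rightarrow> var set" where
  "occ_vars (Eq u v) = {u, v}"
| "occ_vars (Neq u v) = {u, v}"
| "occ_vars (Rel R vs) = set vs"
| "occ_vars (NegRel R vs) = set vs"
| "occ_vars (ys \<bottom>\<^bsub>xs\<^esub> zs) = set ys \<union> set xs \<union> set zs"
| "occ_vars (And \<phi> \<psi>) = occ_vars \<phi> \<union> occ_vars \<psi>"
| "occ_vars (Or \<phi> \<psi>) = occ_vars \<phi> \<union> occ_vars \<psi>"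
| "occ_vars (Ex v \<phi>) = insert v (occ_vars \<phi>)"
| "occ_vars (All v \<phi>) = insert v (occ_vars \<phi>)"
| "occ_vars (NewEx v \<phi>) = insert v (occ_vars \<phi>)"
| "occ_vars (NewAll v \<phi>) = insert v (occ_vars \<phi>)"

text \<open>Identities between variables of different sorts are allowed.\<close>

primrec formula_of :: "'r vocab \<Rightarrow> 'r fm \<Rightarrow> bool" where
  "formula_of \<tau> (Eq u v) \<longleftrightarrow> {sort_of u, sort_of v} \<subseteq> sorts \<tau>"
| "formula_of \<tau> (Neq u v) \<longleftrightarrow> {sort_of u, sort_of v} \<subseteq> sorts \<tau>"
| "formula_of \<tau> (Rel R vs) \<longleftrightarrow> rel_sorts \<tau> R = Some (map sort_of vs)"
| "formula_of \<tau> (NegRel R vs) \<longleftrightarrow> rel_sorts \<tau> R = Some (map sort_of vs)"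
| "formula_of \<tau> (ys \<bottom>\<^bsub>xs\<^esub> zs) \<longleftrightarrow> sort_of ` (set ys \<union> set xs \<union> set zs) \<subseteq> sorts \<tau>"
| "formula_of \<tau> (And \<phi> \<psi>) \<longleftrightarrow> formula_of \<tau> \<phi> \<and> formula_of \<tau> \<psi>"
| "formula_of \<tau> (Or \<phi> \<psi>) \<longleftrightarrow> formula_of \<tau> \<phi> \<and> formula_of \<tau> \<psi>"
| "formula_of \<tau> (Ex v \<phi>) \<longleftrightarrow> sort_of v \<in> sorts \<tau> \<and> formula_of \<tau> \<phi>"
| "formula_of \<tau> (All v \<phi>) \<longleftrightarrow> sort_of v \<in> sorts \<tau> \<and> formula_of \<tau> \<phi>"
| "formula_of \<tau> (NewEx v \<phi>) \<longleftrightarrow> sort_of v \<notin> sorts \<tau> \<and> formula_of (add_sort (sort_of v) \<tau>) \<phi>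
     \<and> (\<forall>u \<in> free_vars \<phi>. sort_of u = sort_of v \<longrightarrow> u = v)"
| "formula_of \<tau> (NewAll v \<phi>) \<longleftrightarrow> sort_of v \<notin> sorts \<tau> \<and> formula_of (add_sort (sort_of v) \<tau>) \<phi>
     \<and> (\<forall>u \<in> free_vars \<phi>. sort_of u = sort_of v \<longrightarrow> u = v)"

definition common_vocabulary :: "'r fm set \<Rightarrow> bool" where
  "common_vocabulary \<Phi> \<longleftrightarrow> (\<exists>\<tau>. vocabulary \<tau> \<and> (\<forall>\<phi> \<in> \<Phi>. formula_of \<tau> \<phi>))"

primrec dependence_logic :: "'r fm \<Rightarrow> bool" where
  "dependence_logic (Eq u v) \<longleftrightarrow> True"
| "dependence_logic (Neq u v) \<longleftrightarrow> True"
| "dependence_logic (Rel R vs) \<longleftrightarrow> True"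
| "dependence_logic (NegRel R vs) \<longleftrightarrow> True"
| "dependence_logic (ys \<bottom>\<^bsub>xs\<^esub> zs) \<longleftrightarrow> ys = zs"
| "dependence_logic (And \<phi> \<psi>) \<longleftrightarrow> dependence_logic \<phi> \<and> dependence_logic \<psi>"
| "dependence_logic (Or \<phi> \<psi>) \<longleftrightarrow> dependence_logic \<phi> \<and> dependence_logic \<psi>"
| "dependence_logic (Ex v \<phi>) \<longleftrightarrow> dependence_logic \<phi>"
| "dependence_logic (All v \<phi>) \<longleftrightarrow> dependence_logic \<phi>"
| "dependence_logic (NewEx v \<phi>) \<longleftrightarrow> dependence_logic \<phi>"
| "dependence_logic (NewAll v \<phi>) \<longleftrightarrow> dependence_logic \<phi>"

text \<open>\<open>subst y x \<phi>\<close> is the result of writing \<open>y\<close> for every free occurrence of \<open>x\<close> in \<open>\<phi>\<close>.\<close>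

primrec subst :: "var \<Rightarrow> var \<Rightarrow> 'r fm \<Rightarrow> 'r fm" where
  "subst y x (Eq u v) = Eq ((id(x := y)) u) ((id(x := y)) v)"
| "subst y x (Neq u v) = Neq ((id(x := y)) u) ((id(x := y)) v)"
| "subst y x (Rel R vs) = Rel R (map (id(x := y)) vs)"
| "subst y x (NegRel R vs) = NegRel R (map (id(x := y)) vs)"
| "subst y x (us \<bottom>\<^bsub>vs\<^esub> ws) =
     map (id(x := y)) us \<bottom>\<^bsub>map (id(x := y)) vs\<^esub> map (id(x := y)) ws"
| "subst y x (And \<phi> \<psi>) = And (subst y x \<phi>) (subst y x \<psi>)"
| "subst y x (Or \<phi> \<psi>) = Or (subst y x \<phi>) (subst y x \<psi>)"
| "subst y x (Ex v \<phi>) = Ex v (if v = x then \<phi> else subst y x \<phi>)"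
| "subst y x (All v \<phi>) = All v (if v = x then \<phi> else subst y x \<phi>)"
| "subst y x (NewEx v \<phi>) = NewEx v (if v = x then \<phi> else subst y x \<phi>)"
| "subst y x (NewAll v \<phi>) = NewAll v (if v = x then \<phi> else subst y x \<phi>)"

text \<open>
  \<open>free_for y x \<phi>\<close>: no free occurrence of \<open>x\<close> in \<open>\<phi>\<close> lies in the scope of a quantifier
  over \<open>y\<close>.
\<close>

primrec free_for :: "var \<Rightarrow> var \<Rightarrow> 'r fm \<Rightarrow> bool" where
  "free_for y x (Eq u v) \<longleftrightarrow> True"
| "free_for y x (Neq u v) \<longleftrightarrow> True"
| "free_for y x (Rel R vs) \<longleftrightarrow> True"
| "free_for y x (NegRel R vs) \<longleftrightarrow> True"
| "free_for y x (us \<bottom>\<^bsub>vs\<^esub> ws) \<longleftrightarrow> True"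
| "free_for y x (And \<phi> \<psi>) \<longleftrightarrow> free_for y x \<phi> \<and> free_for y x \<psi>"
| "free_for y x (Or \<phi> \<psi>) \<longleftrightarrow> free_for y x \<phi> \<and> free_for y x \<psi>"
| "free_for y x (Ex v \<phi>) \<longleftrightarrow> x \<in> free_vars \<phi> - {v} \<longrightarrow> v \<noteq> y \<and> free_for y x \<phi>"
| "free_for y x (All v \<phi>) \<longleftrightarrow> x \<in> free_vars \<phi> - {v} \<longrightarrow> v \<noteq> y \<and> free_for y x \<phi>"
| "free_for y x (NewEx v \<phi>) \<longleftrightarrow> x \<in> free_vars \<phi> - {v} \<longrightarrow> v \<noteq> y \<and> free_for y x \<phi>"
| "free_for y x (NewAll v \<phi>) \<longleftrightarrow> x \<in> free_vars \<phi> - {v} \<longrightarrow> v \<noteq> y \<and> free_for y x \<phi>"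

section \<open>Derivability\<close>

text \<open>
  The rules without a derivation among their premises, as pairs of a set of premises and a
  conclusion. In \<open>i_weakening\<close> the two deleted items are single variables.
\<close>

inductive axiom_rule :: "'r fm set \<Rightarrow> 'r fm \<Rightarrow> bool" where
  \<comment> \<open>independence atom\<close>
  i_constancy: "axiom_rule {ys \<bottom>\<^bsub>xs\<^esub> ys} (ys \<bottom>\<^bsub>xs\<^esub> zs)"
| i_reflexivity: "axiom_rule {} (xs \<bottom>\<^bsub>xs\<^esub> ys)"
| i_symmetry: "axiom_rule {zs \<bottom>\<^bsub>xs\<^esub> ys} (ys \<bottom>\<^bsub>xs\<^esub> zs)"
| i_weakening: "axiom_rule {(ys @ [y']) \<bottom>\<^bsub>xs\<^esub> (zs @ [z'])} (ys \<bottom>\<^bsub>xs\<^esub> zs)"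
| i_permutation: "mset ys = mset ys' \<Longrightarrow> mset xs = mset xs' \<Longrightarrow> mset zs = mset zs'
    \<Longrightarrow> axiom_rule {ys \<bottom>\<^bsub>xs\<^esub> zs} (ys' \<bottom>\<^bsub>xs'\<^esub> zs')"
| i_fixed_parameter: "axiom_rule {zs \<bottom>\<^bsub>xs\<^esub> ys} ((ys @ xs) \<bottom>\<^bsub>xs\<^esub> (zs @ xs))"
| i_first_transitivity:
    "axiom_rule {And (xs \<bottom>\<^bsub>zs\<^esub> ys) (us \<bottom>\<^bsub>zs @ xs\<^esub> ys)} (us \<bottom>\<^bsub>zs\<^esub> ys)"
| i_second_transitivity:
    "axiom_rule {And (ys \<bottom>\<^bsub>zs\<^esub> ys) ((zs @ xs) \<bottom>\<^bsub>ys\<^esub> us)} (xs \<bottom>\<^bsub>zs\<^esub> us)"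
| i_exchange:
    "axiom_rule {And (xs \<bottom>\<^bsub>zs\<^esub> ys) ((xs @ ys) \<bottom>\<^bsub>zs\<^esub> us)} (xs \<bottom>\<^bsub>zs\<^esub> (ys @ us))"
  \<comment> \<open>dependence atom\<close>
| d_projection: "axiom_rule {} (dep (xs @ ys) xs)"
| d_transitivity: "axiom_rule {And (dep xs ys) (dep ys zs)} (dep xs zs)"
| d_extension: "axiom_rule {dep xs ys} (dep xs (xs @ ys))"
| d_permutation: "mset xs = mset xs' \<Longrightarrow> mset ys = mset ys'
    \<Longrightarrow> axiom_rule {dep xs ys} (dep xs' ys')"
  \<comment> \<open>semigraphoid axioms\<close>
| s_empty: "axiom_rule {} (xs \<bottom>\<^bsub>zs\<^esub> [])"
| s_symmetry: "axiom_rule {zs \<bottom>\<^bsub>xs\<^esub> ys} (ys \<bottom>\<^bsub>xs\<^esub> zs)"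
| s_decomposition: "axiom_rule {xs \<bottom>\<^bsub>zs\<^esub> (ys @ ws)} (xs \<bottom>\<^bsub>zs\<^esub> ys)"
| s_weak_union: "axiom_rule {xs \<bottom>\<^bsub>zs\<^esub> (ys @ ws)} (xs \<bottom>\<^bsub>zs @ ws\<^esub> ys)"
| s_contraction:
    "axiom_rule {And (xs \<bottom>\<^bsub>zs\<^esub> ys) (xs \<bottom>\<^bsub>zs @ ys\<^esub> ws)} (xs \<bottom>\<^bsub>zs\<^esub> (ys @ ws))"
| s_permutation: "mset ys = mset ys' \<Longrightarrow> mset xs = mset xs' \<Longrightarrow> mset zs = mset zs'
    \<Longrightarrow> axiom_rule {ys \<bottom>\<^bsub>xs\<^esub> zs} (ys' \<bottom>\<^bsub>xs'\<^esub> zs')"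
| s_repetition: "axiom_rule {xs \<bottom>\<^bsub>zs\<^esub> ys} ((xs @ xs) \<bottom>\<^bsub>zs @ zs\<^esub> (ys @ ys))"
  \<comment> \<open>logical rules\<close>
| ex_intro: "sort_of y = sort_of x \<Longrightarrow> free_for y x \<phi> \<Longrightarrow> axiom_rule {subst y x \<phi>} (Ex x \<phi>)"
| and_elim1: "axiom_rule {And \<phi> \<psi>} \<phi>"
| and_elim2: "axiom_rule {And \<phi> \<psi>} \<psi>"
| and_intro: "axiom_rule {\<phi>, \<psi>} (And \<phi> \<psi>)"
| dependence_intro: "dependence_logic \<phi> \<Longrightarrow> distinct zs \<Longrightarrow> set zs = free_vars (Ex x \<phi>)
    \<Longrightarrow> axiom_rule {Ex x \<phi>} (Ex x (And (dep zs [x]) \<phi>))"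

text \<open>
  The side conditions on \<open>common_vocabulary\<close> confine derivability to pairs of a set of formulas
  and a formula that belong to one vocabulary. The vocabulary may change in the course of a
  derivation: the two rules for \<open>NewEx\<close> remove a sort from it.
\<close>

inductive derives :: "'r fm set \<Rightarrow> 'r fm \<Rightarrow> bool"  (infix "\<turnstile>" 50) where
  assumption: "\<phi> \<in> \<Sigma> \<Longrightarrow> common_vocabulary \<Sigma> \<Longrightarrow> \<Sigma> \<turnstile> \<phi>"
| weakening: "\<Sigma> \<turnstile> \<psi> \<Longrightarrow> \<Sigma> \<subseteq> \<Sigma>' \<Longrightarrow> common_vocabulary (insert \<psi> \<Sigma>') \<Longrightarrow> \<Sigma>' \<turnstile> \<psi>"
| cut: "\<Sigma> \<turnstile> \<phi> \<Longrightarrow> insert \<phi> \<Sigma>' \<turnstile> \<psi> \<Longrightarrow> common_vocabulary (insert \<psi> (\<Sigma> \<union> \<Sigma>'))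
    \<Longrightarrow> \<Sigma> \<union> \<Sigma>' \<turnstile> \<psi>"
| axiom_rule: "axiom_rule \<Sigma> \<psi> \<Longrightarrow> common_vocabulary (insert \<psi> \<Sigma>) \<Longrightarrow> \<Sigma> \<turnstile> \<psi>"
| ex_elim: "insert \<phi> \<Sigma> \<turnstile> \<psi> \<Longrightarrow> x \<notin> free_vars \<psi> \<Longrightarrow> \<forall>\<chi> \<in> \<Sigma>. x \<notin> free_vars \<chi>
    \<Longrightarrow> common_vocabulary (insert \<psi> (insert (Ex x \<phi>) \<Sigma>))
    \<Longrightarrow> insert (Ex x \<phi>) \<Sigma> \<turnstile> \<psi>"
| new_ex_intro1: "\<Sigma> \<turnstile> Ex x \<phi> \<Longrightarrow> \<forall>\<chi> \<in> \<Sigma>. sort_of x \<notin> sort_of ` occ_vars \<chi>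
    \<Longrightarrow> common_vocabulary (insert (NewEx x \<phi>) \<Sigma>)
    \<Longrightarrow> \<Sigma> \<turnstile> NewEx x \<phi>"
| new_ex_intro2: "insert (Ex x \<phi>) \<Sigma> \<turnstile> Ex y \<psi> \<Longrightarrow> sort_of y = sort_of x
    \<Longrightarrow> \<forall>\<chi> \<in> \<Sigma>. sort_of x \<notin> sort_of ` occ_vars \<chi>
    \<Longrightarrow> common_vocabulary (insert (NewEx y \<psi>) (insert (NewEx x \<phi>) \<Sigma>))
    \<Longrightarrow> insert (NewEx x \<phi>) \<Sigma> \<turnstile> NewEx y \<psi>"

lemma derives_common_vocabulary: "\<Sigma> \<turnstile> \<psi> \<Longrightarrow> common_vocabulary (insert \<psi> \<Sigma>)"
  by (induction rule: derives.induct) (auto simp: insert_absorb)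

end

theory Submission
  imports Defs
begin

text \<open>A dependence atom says that the determined tuple is independent of itself, so by
  Constancy it is independent of every tuple. Taking that tuple to be part of \<open>ys\<close> and
  then dropping this part from \<open>ys\<close> leaves the independence of two complementary parts
  of \<open>ys\<close>; this is \<open>dep_derives_Indep\<close>. Each conjunct is the case where
  one part is a single position, and \<open>derives_bigconj\<close> collects the conjuncts.\<close>

text \<open>One vocabulary for all side conditions: only independence atoms and conjunctions occur,
  so having every sort and no relation symbol is enough.\<close>

definition full_vocab :: "'r vocab" where
  "full_vocab = \<lparr>sorts = UNIV, rel_sorts = \<lambda>_. None\<rparr>"

lemma sorts_full_vocab [simp]: "sorts full_vocab = UNIV"
  by (simp add: full_vocab_def)

lemma common_vocabulary_fullI:
  assumes "\<And>\<phi>. \<phi> \<in> \<Phi> \<Longrightarrow> formula_of full_vocab \<phi>"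
  shows "common_vocabulary \<Phi>"
proof -
  have "vocabulary (full_vocab :: 'a vocab)"
    by (simp add: vocabulary_def full_vocab_def)
  with assms show ?thesis
    unfolding common_vocabulary_def by blast
qed

lemma derives_axiom_rule:
  assumes "\<Sigma> \<turnstile> \<phi>" and "axiom_rule {\<phi>} \<psi>"
    and "common_vocabulary (insert \<psi> (insert \<phi> \<Sigma>))"
  shows "\<Sigma> \<turnstile> \<psi>"
proof -
  have "common_vocabulary {\<psi>, \<phi>}" and cv: "common_vocabulary (insert \<psi> \<Sigma>)"
    using assms(3) by (auto simp: common_vocabulary_def)
  with assms(2) have "insert \<phi> {} \<turnstile> \<psi>"
    by (intro derives.axiom_rule) auto
  with cut[OF assms(1) this] cv show ?thesis by simp
qed

text \<open>Two cuts against the introduction rule for \<open>And\<close>, each discharging one of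
  its premises.\<close>

lemma derives_And:
  assumes "\<Sigma> \<turnstile> \<phi>" and "\<Sigma> \<turnstile> \<psi>" and cv: "common_vocabulary (insert \<phi> (insert \<psi> \<Sigma>))"
  shows "\<Sigma> \<turnstile> And \<phi> \<psi>"
proof -
  obtain \<tau> where \<tau>: "vocabulary \<tau>" "\<forall>\<chi> \<in> insert (And \<phi> \<psi>) (insert \<phi> (insert \<psi> \<Sigma>)). formula_of \<tau> \<chi>"
    using cv by (auto simp: common_vocabulary_def)
  have cvI: "common_vocabulary \<Phi>" if "\<Phi> \<subseteq> insert (And \<phi> \<psi>) (insert \<phi> (insert \<psi> \<Sigma>))" for \<Phi>
    using \<tau> that unfolding common_vocabulary_def by blast
  have "insert \<phi> {\<psi>} \<turnstile> And \<phi> \<psi>"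
    by (intro derives.axiom_rule axiom_rule.and_intro cvI) auto
  from cut[OF assms(1) this] have "insert \<psi> \<Sigma> \<turnstile> And \<phi> \<psi>"
    by (simp add: cvI insert_mono subset_insertI2)
  from cut[OF assms(2) this] show ?thesis
    by (simp add: cvI insert_mono subset_insertI2)
qed

lemma formula_of_full_vocab_bigconj:
  "(\<And>\<phi>. \<phi> \<in> set \<phi>s \<Longrightarrow> formula_of full_vocab \<phi>) \<Longrightarrow> formula_of full_vocab (bigconj \<phi>s)"
  by (induction \<phi>s rule: bigconj.induct) auto

lemma derives_bigconj:
  assumes "\<And>\<phi>. \<phi> \<in> set \<phi>s \<Longrightarrow> \<Sigma> \<turnstile> \<phi>"
    and "\<And>\<phi>. \<phi> \<in> set \<phi>s \<union> \<Sigma> \<Longrightarrow> formula_of full_vocab \<phi>"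
  shows "\<Sigma> \<turnstile> bigconj \<phi>s"
  using assms
proof (induction \<phi>s rule: bigconj.induct)
  case 1
  \<comment> \<open>The atom standing for the empty conjunction is an instance of the semigraphoid
    axiom for the empty tuple.\<close>
  have "{} \<turnstile> ([] \<bottom>\<^bsub>[]\<^esub> [])"
    by (intro derives.axiom_rule axiom_rule.s_empty common_vocabulary_fullI) auto
  then have "\<Sigma> \<turnstile> ([] \<bottom>\<^bsub>[]\<^esub> [])"
    by (rule weakening) (use 1(2) in \<open>auto intro!: common_vocabulary_fullI\<close>)
  then show ?case by simp
next
  case (2 \<phi>)
  then show ?case by simp
next
  case (3 \<phi> \<psi> \<chi>s)
  have "formula_of full_vocab (bigconj (\<psi> # \<chi>s))"
    using 3 by (intro formula_of_full_vocab_bigconj) auto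
  then have "\<Sigma> \<turnstile> And \<phi> (bigconj (\<psi> # \<chi>s))"
    using 3 by (intro derives_And common_vocabulary_fullI) auto
  then show ?case by simp
qed

text \<open>Stated with multisets, so that repeated variables in \<open>ys\<close> need no special
  treatment.\<close>

lemma dep_derives_Indep:
  assumes "mset ys = mset (us @ vs)"
  shows "{dep xs ys :: 'r fm} \<turnstile> (us \<bottom>\<^bsub>xs\<^esub> vs)"
proof -
  have step: "{dep xs ys :: 'r fm} \<turnstile> (as \<bottom>\<^bsub>bs\<^esub> cs)"
    if "{dep xs ys :: 'r fm} \<turnstile> (as' \<bottom>\<^bsub>bs'\<^esub> cs')"
      and "axiom_rule {as' \<bottom>\<^bsub>bs'\<^esub> cs'} ((as \<bottom>\<^bsub>bs\<^esub> cs) :: 'r fm)"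
    for as bs cs as' bs' cs'
    using that by (rule derives_axiom_rule) (auto intro!: common_vocabulary_fullI)
  have "{dep xs ys :: 'r fm} \<turnstile> dep xs ys"
    by (auto intro!: assumption common_vocabulary_fullI)
  \<comment> \<open>Constancy leaves the third tuple free; \<open>vs\<close> is the part to be kept
    there.\<close>
  then have "{dep xs ys :: 'r fm} \<turnstile> (ys \<bottom>\<^bsub>xs\<^esub> vs)"
    by (rule step) (rule i_constancy)
  then have "{dep xs ys :: 'r fm} \<turnstile> (vs \<bottom>\<^bsub>xs\<^esub> ys)"
    by (rule step) (rule i_symmetry)
  then have "{dep xs ys :: 'r fm} \<turnstile> (vs \<bottom>\<^bsub>xs\<^esub> (us @ vs))"
    by (rule step) (use assms in \<open>auto intro: i_permutation\<close>)
  \<comment> \<open>Decomposition shortens one side only, whereas \<open>i_weakening\<close> would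
    also take a variable from the other side.\<close>
  then have "{dep xs ys :: 'r fm} \<turnstile> (vs \<bottom>\<^bsub>xs\<^esub> us)"
    by (rule step) (rule s_decomposition)
  then show ?thesis
    by (rule step) (rule i_symmetry)
qed

lemma mset_nth_Cons_remove_nth:
  assumes "i < length xs"
  shows "mset xs = mset (xs ! i # [xs ! j. j \<leftarrow> [0..<length xs], j \<noteq> i])"
proof -
  \<comment> \<open>Positions are distinct even if entries are not, so for lists of positions
    equality of sets suffices; mapping to entries then preserves multiplicities.\<close>
  have "mset [0..<length xs] = mset (i # filter (\<lambda>j. j \<noteq> i) [0..<length xs])"
    using assms by (subst set_eq_iff_mset_eq_distinct[symmetric]) auto
  then have "mset (map ((!) xs) [0..<length xs])
      = mset (map ((!) xs) (i # filter (\<lambda>j. j \<noteq> i) [0..<length xs]))"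
    by (simp only: mset_map)
  \<comment> \<open>The comprehension abbreviates a \<open>concat\<close>, hence the induction over
    an arbitrary \<open>js\<close>.\<close>
  moreover have "[xs ! j. j \<leftarrow> js, j \<noteq> i] = map ((!) xs) (filter (\<lambda>j. j \<noteq> i) js)" for js
    by (induction js) auto
  ultimately show ?thesis
    by (simp add: map_nth)
qed

theorem lemma3p13:
  fixes xs ys zs :: "var list" and n l :: nat
  assumes "length xs = n" and "length ys = n" and "length zs = l"
  shows "{dep (xs @ zs) ys :: 'r fm} \<turnstile>
    bigconj (map (\<lambda>i. [ys ! i] \<bottom>\<^bsub>xs @ zs\<^esub> [ys ! j. j \<leftarrow> [0..<n], j \<noteq> i]) [0..<n])"
proof (rule derives_bigconj)
  fix \<phi> :: "'r fm"
  assume "\<phi> \<in> set (map (\<lambda>i. [ys ! i] \<bottom>\<^bsub>xs @ zs\<^esub> [ys ! j. j \<leftarrow> [0..<n], j \<noteq> i]) [0..<n])"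
  then obtain i where i: "i < n"
    and \<phi>: "\<phi> = ([ys ! i] \<bottom>\<^bsub>xs @ zs\<^esub> [ys ! j. j \<leftarrow> [0..<n], j \<noteq> i])"
    by auto
  \<comment> \<open>The splitting of \<open>ys\<close> for \<open>dep_derives_Indep\<close>:
    position \<open>i\<close> against all others.\<close>
  have "mset ys = mset ([ys ! i] @ [ys ! j. j \<leftarrow> [0..<n], j \<noteq> i])"
    using mset_nth_Cons_remove_nth[of i ys] i assms(2) by simp
  then show "{dep (xs @ zs) ys} \<turnstile> \<phi>"
    unfolding \<phi> by (rule dep_derives_Indep)
qed auto

end
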